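(* For each $k=1,2,\ldots$ let $n(k),m(k)$ be integers with $1\le n(k)\le m(k)$, let $q(k)\in(0,1)$, and put $\ell(k)=m(k)-n(k)+1$. Assume that $$\ell(k)\,\log\bigl(q(k)^{-1}\bigr)-\log m(k)\to\infty\qquad\text{as }k\to\infty.$$ Then the total variation distance between the stationary distribution of the bounded geometric juggler's exclusion process and that of its unbounded variant satisfies $$\bigl\|\pi_{m(k),n(k),q(k)}-\pi_{\infty,n(k),q(k)}\bigr\|_{\rm TV}\to0\qquad\text{as }k\to\infty.$$
   Context: $\mathbb{Z}_+=\{0,1,2,\ldots\}$ and $\mathbb{Z}_+^{(n)}=\{A\subset\mathbb{Z}_+:|A|=n\}$. For a finite set $A\subset\mathbb{Z}_+$, $\theta_A$ denotes the order-preserving bijection from $\mathbb{Z}_+$ onto $\mathbb{Z}_+\setminus A$. For a set $X$ of integers, $X-1=\{x-1:x\in X\}$. The bounded geometric juggler's exclusion process (JEP) with $n$ particles, $m\ge n$ admissible heights and parameter $q\in(0,1)$ is the Markov chain $(X_t)_{t\ge0}$ on the $n$-element subsets of $\{0,\ldots,m-1\}$ with the following dynamics. If $0\notin X_t$, then $X_{t+1}=X_t-1$. If $0\in X_t$, put $X_t^*=(X_t\setminus\{0\})-1$; then $X_{t+1}=X_t^*\cup\{\theta_{X_t^*}(\xi_t)\}$, where the $\xi_t$ are independent random integers (independent of $X_0$) with the truncated geometric distribution $\mathrm{P}(\xi_t=x)=\frac{1-q}{1-q^{\ell}}q^x$ for $x\in\{0,\ldots,\ell-1\}$, with $\ell=m-n+1$.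 It is known to have a unique stationary distribution $\pi_{m,n,q}$, which is viewed as a probability distribution on $\mathbb{Z}_+^{(n)}$ whose mass is concentrated on the $n$-element subsets of $\{0,\ldots,m-1\}$. The unbounded geometric JEP with $n$ particles and parameter $q$ is the Markov chain on $\mathbb{Z}_+^{(n)}$ with the same dynamics, except that the $\xi_t$ have the geometric distribution $\mathrm{P}(\xi_t=x)=(1-q)q^x$, $x\in\mathbb{Z}_+$. Its stationary distribution is known to be $$\pi_{\infty,n,q}(B)=\frac{(q;q)_n}{q^{\binom n2}}\prod_{x\in B}q^x,\qquad B\in\mathbb{Z}_+^{(n)},$$ where $(q;q)_n=\prod_{i=1}^n(1-q^i)$. The total variation distance between probability distributions $\mu,\nu$ on a countable set $S$ is $\|\mu-\nu\|_{\rm TV}=\frac12\sum_{A\in S}|\mu(A)-\nu(A)|$. *)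

theory Defs
  imports "HOL-Probability.Probability" "HOL-Library.Ramsey"
begin

text \<open>
  Heights are natural numbers. The set of \<open>n\<close>-element subsets of \<open>S\<close> is \<open>nsets S n\<close>, so the
  states of the unbounded chain form \<open>nsets UNIV n\<close> and those of the bounded chain with \<open>m\<close>
  admissible heights form \<open>nsets {..<m} n\<close>.
\<close>

definition theta :: "nat set \<Rightarrow> nat \<Rightarrow> nat" where
  "theta A = enumerate (- A)"

lemma theta_order_bijection:
  assumes "finite A"
  shows "strict_mono (theta A)" "bij_betw (theta A) UNIV (- A)"
proof -
  have inf: "infinite (- A)"
    using assms by (simp add: Compl_eq_Diff_UNIV)
  show "strict_mono (theta A)"
    unfolding theta_def using inf by (rule strict_mono_enumerate)
  show "bij_betw (theta A) UNIV (- A)"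
    unfolding theta_def using inf by (rule bij_enumerate)
qed

text \<open>The shift \<open>X - 1\<close>; it is only ever applied to sets not containing \<open>0\<close>.\<close>

definition shift_down :: "nat set \<Rightarrow> nat set" where
  "shift_down X = (\<lambda>x. x - 1) ` X"

definition jep_step :: "nat pmf \<Rightarrow> nat set \<Rightarrow> nat set pmf" where
  "jep_step xi X =
     (if 0 \<notin> X then return_pmf (shift_down X)
      else (let Y = shift_down (X - {0}) in map_pmf (\<lambda>x. insert (theta Y x) Y) xi))"

definition trunc_geometric_pmf :: "real \<Rightarrow> nat \<Rightarrow> nat pmf" where
  "trunc_geometric_pmf q l =
     embed_pmf (\<lambda>x. if x < l then (1 - q) / (1 - q ^ l) * q ^ x else 0)"

lemma pmf_trunc_geometric:
  assumes "0 < q" "q < 1" "0 < l"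
  shows "pmf (trunc_geometric_pmf q l) x = (if x < l then (1 - q) / (1 - q ^ l) * q ^ x else 0)"
proof -
  let ?f = "\<lambda>x. if x < l then (1 - q) / (1 - q ^ l) * q ^ x else 0"
  have ql: "q ^ l < 1"
    using assms by (simp add: power_less_one_iff)
  have nonneg: "0 \<le> ?f x" for x
    using assms ql by simp
  have "(\<integral>\<^sup>+x. ennreal (?f x) \<partial>count_space UNIV) = (\<Sum>x<l. ennreal (?f x))"
    by (rule nn_integral_count_space') (auto simp: assms)
  also have "\<dots> = ennreal (\<Sum>x<l. ?f x)"
    by (rule sum_ennreal) (rule nonneg)
  also have "(\<Sum>x<l. ?f x) = (1 - q) / (1 - q ^ l) * (\<Sum>x<l. q ^ x)"
    by (simp add: sum_distrib_left)
  also have "\<dots> = 1"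
    using assms ql by (simp add: sum_gp_strict)
  finally have "(\<integral>\<^sup>+x. ennreal (?f x) \<partial>count_space UNIV) = 1"
    by simp
  with nonneg show ?thesis
    unfolding trunc_geometric_pmf_def by (rule pmf_embed_pmf)
qed

text \<open>
  \<open>geometric_pmf p\<close> has success parameter \<open>p\<close>, so the throw distribution
  \<open>(1 - q) * q ^ x\<close> is \<open>geometric_pmf (1 - q)\<close>.
\<close>

definition bounded_jep :: "nat \<Rightarrow> nat \<Rightarrow> real \<Rightarrow> nat set \<Rightarrow> nat set pmf" where
  "bounded_jep m n q = jep_step (trunc_geometric_pmf q (m - n + 1))"

definition unbounded_jep :: "real \<Rightarrow> nat set \<Rightarrow> nat set pmf" where
  "unbounded_jep q = jep_step (geometric_pmf (1 - q))"

definition is_stationary :: "'a set \<Rightarrow> ('a \<Rightarrow> 'a pmf) \<Rightarrow> 'a pmf \<Rightarrow> bool" where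
  "is_stationary S K p \<longleftrightarrow> set_pmf p \<subseteq> S \<and> bind_pmf p K = p"

text \<open>
  The description is proper for both chains below whenever \<open>1 \<le> n \<le> m\<close> and \<open>0 < q < 1\<close>:
  each then has exactly one stationary distribution.
\<close>

definition stationary_pmf :: "'a set \<Rightarrow> ('a \<Rightarrow> 'a pmf) \<Rightarrow> 'a pmf" where
  "stationary_pmf S K = (THE p. is_stationary S K p)"

definition pi_bounded :: "nat \<Rightarrow> nat \<Rightarrow> real \<Rightarrow> nat set pmf" where
  "pi_bounded m n q = stationary_pmf (nsets {..<m} n) (bounded_jep m n q)"

text \<open>
  For \<open>0 < q < 1\<close> this has mass \<open>(\<Prod>i=1..n. 1 - q ^ i) / q ^ (n choose 2) * (\<Prod>x\<in>B. q ^ x)\<close>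
  at each \<open>B\<close> in \<open>nsets UNIV n\<close>; this formula is a property of the chain, not its definition.
\<close>

definition pi_unbounded :: "nat \<Rightarrow> real \<Rightarrow> nat set pmf" where
  "pi_unbounded n q = stationary_pmf (nsets UNIV n) (unbounded_jep q)"

definition tv_dist :: "'a set \<Rightarrow> 'a pmf \<Rightarrow> 'a pmf \<Rightarrow> real" where
  "tv_dist S p p' = 1 / 2 * (\<Sum>\<^sub>\<infinity>A\<in>S. \<bar>pmf p A - pmf p' A\<bar>)"

end

theory Submission imports Defs begin

text \<open>
  Let \<open>F s\<close> be the probability that a throw is at least \<open>s\<close>. For any throw distribution the weight
  \<open>W(B) = \<Prod>x\<in>B. F (number of holes of B below x)\<close> solves the balance equation by telescoping over
  the particle thrown last, so both stationary distributions are normalised weights; here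
  \<open>F s = q^s\<close> for the unbounded chain and \<open>F s = (q^s - q^l) / (1 - q^l)\<close> for \<open>s < l\<close>, and \<open>0\<close>
  beyond, for the bounded one. The second weight is at most the first, so the total
  variation distance is at most \<open>1 - Z / Y\<close>, where \<open>Z \<le> Y\<close> are the two normalising constants.

  Subsets of \<open>{..<m}\<close> of size \<open>n\<close> correspond to weakly increasing sequences of hole counts, so the
  partition function is the complete homogeneous symmetric polynomial
  \<open>h_n(F 0, \<dots>, F (m - n))\<close>. Subtracting \<open>c\<close> from each of the \<open>l\<close> variables decreases \<open>h_n\<close> by at
  most \<open>(l + n - 1) c h_{n-1}\<close>, and \<open>h_n(1, q, \<dots>, q^{l-1})\<close> is a Gaussian binomial coefficient.
  With \<open>c = q^l\<close> this gives \<open>1 - Z / Y \<le> 3 m q^l\<close>, which tends to \<open>0\<close> under the hypothesis.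
\<close>

subsection \<open>Uniqueness of stationary distributions\<close>

text \<open>
  Since \<open>a = min p p'\<close> satisfies \<open>a K \<le> a\<close> with equal total masses, \<open>a\<close> is invariant, and so is
  \<open>p - a\<close>; the support of an invariant measure is closed under transitions.
\<close>

lemma stationary_mono_step:
  fixes K :: "'a \<Rightarrow> 'a pmf"
  assumes p: "bind_pmf p K = p" and p': "bind_pmf p' K = p'"
    and less: "pmf p' x < pmf p x" and y: "y \<in> set_pmf (K x)"
  shows "pmf p' y < pmf p y"
proof -
  define a where "a x = min (pmf p x) (pmf p' x)" for x
  define T where "T f y = (\<integral>\<^sup>+x. ennreal (f x) * ennreal (pmf (K x) y) \<partial>count_space UNIV)" for f y
  have T_pmf: "T (pmf r) y = ennreal (pmf r y)" if "bind_pmf r K = r" for r y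
    using ennreal_pmf_bind[of r K y] that unfolding T_def by (simp add: nn_integral_measure_pmf)
  have a_nn: "0 \<le> a x" for x by (simp add: a_def)
  have T_le: "T a y \<le> ennreal (a y)" for y
  proof -
    have *: "T a y \<le> ennreal (pmf r y)" if "bind_pmf r K = r" "\<And>x. a x \<le> pmf r x" for r
    proof -
      have "T a y \<le> T (pmf r) y"
        unfolding T_def by (intro nn_integral_mono mult_right_mono ennreal_leI that(2)) auto
      then show ?thesis using T_pmf[OF that(1)] by simp
    qed
    have "T a y \<le> ennreal (pmf p y)"
      using p by (rule *) (simp add: a_def)
    moreover have "T a y \<le> ennreal (pmf p' y)"
      using p' by (rule *) (simp add: a_def)
    ultimately show ?thesis by (simp add: a_def min_def)
  qed
  \<comment> \<open>Tonelli and the unit mass of every \<open>K x\<close>: a transition preserves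
    total mass. As that mass is finite, the pointwise inequality \<open>T_le\<close> is forced to be
    an equality.\<close>
  have "(\<integral>\<^sup>+y. T a y \<partial>count_space UNIV)
      = (\<integral>\<^sup>+x. (\<integral>\<^sup>+y. ennreal (a x) * ennreal (pmf (K x) y) \<partial>count_space UNIV) \<partial>count_space UNIV)"
    unfolding T_def
    using nn_integral_fst_count_space[of "\<lambda>(x,y). ennreal (a x) * ennreal (pmf (K x) y)"]
      nn_integral_snd_count_space[of "\<lambda>(x,y). ennreal (a x) * ennreal (pmf (K x) y)"] by simp
  also have "\<dots> = (\<integral>\<^sup>+x. ennreal (a x) \<partial>count_space UNIV)"
    by (simp add: nn_integral_cmult nn_integral_pmf)
  finally have tot: "(\<integral>\<^sup>+y. T a y \<partial>count_space UNIV) = (\<integral>\<^sup>+x. ennreal (a x) \<partial>count_space UNIV)" .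
  have "(\<integral>\<^sup>+x. ennreal (a x) \<partial>count_space UNIV) \<le> (\<integral>\<^sup>+x. ennreal (pmf p x) \<partial>count_space UNIV)"
    by (intro nn_integral_mono ennreal_leI) (simp add: a_def)
  also have "\<dots> = 1" by (simp add: nn_integral_pmf)
  finally have fin: "(\<integral>\<^sup>+x. ennreal (a x) \<partial>count_space UNIV) \<noteq> \<infinity>"
    by (auto simp: top_unique)
  have "(\<integral>\<^sup>+y. ennreal (a y) - T a y \<partial>count_space UNIV)
      = (\<integral>\<^sup>+y. ennreal (a y) \<partial>count_space UNIV) - (\<integral>\<^sup>+y. T a y \<partial>count_space UNIV)"
    using fin tot T_le by (intro nn_integral_diff) auto
  also have "\<dots> = 0" using tot fin by simp
  finally have "ennreal (a y) - T a y = 0" for y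
    by (subst (asm) nn_integral_0_iff_AE) (auto simp: AE_count_space)
  then have T_a: "T a y = ennreal (a y)" for y
    using T_le[of y] by (meson diff_eq_0_iff_ennreal antisym)
  define u where "u x = pmf p x - a x" for x
  have u_nn: "0 \<le> u x" for x by (simp add: u_def a_def)
  have "T u y + T a y = T (pmf p) y"
    unfolding T_def
    by (subst nn_integral_add[symmetric], simp, simp, rule nn_integral_cong)
       (metis u_nn a_nn add.commute diff_add_cancel distrib_right ennreal_plus u_def)
  then have eq: "T u y + ennreal (a y) = ennreal (pmf p y)"
    using T_a T_pmf[OF p] by simp
  \<comment> \<open>The single predecessor \<open>x\<close> already makes the transported excess
    \<open>T u y\<close> positive.\<close>
  have "0 < ennreal (u x) * ennreal (pmf (K x) y)"
    using less y by (simp add: u_def a_def min_def ennreal_zero_less_mult_iff pmf_positive)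
  also have "\<dots> \<le> T u y"
    unfolding T_def by (rule nn_integral_ge_point) simp
  finally have "0 < T u y" .
  then have "ennreal (a y) < ennreal (pmf p y)"
    unfolding eq[symmetric]
    using ennreal_add_left_cancel_less[of "ennreal (a y)" 0 "T u y"] by (simp add: add.commute)
  then have "a y < pmf p y" using a_nn ennreal_less_iff by blast
  then show ?thesis by (auto simp: a_def min_def split: if_splits)
qed

lemma stationary_mono_reach:
  fixes K :: "'a \<Rightarrow> 'a pmf"
  assumes "bind_pmf p K = p" "bind_pmf p' K = p'"
    and "(x, y) \<in> {(x, y). y \<in> set_pmf (K x)}\<^sup>*" "pmf p' x < pmf p x"
  shows "pmf p' y < pmf p y"
  using assms(3,4) by (induction) (auto intro: stationary_mono_step[OF assms(1,2)])

text \<open>Two different distributions of total mass \<open>1\<close> each exceed the other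
  somewhere. Both strict excesses propagate to the common reachable state \<open>s\<close>, where
  they contradict each other.\<close>

lemma stationary_unique:
  fixes K :: "'a \<Rightarrow> 'a pmf"
  assumes reach: "\<And>x. x \<in> S \<Longrightarrow> (x, s) \<in> {(x, y). y \<in> set_pmf (K x)}\<^sup>*"
    and "is_stationary S K p" "is_stationary S K p'"
  shows "p = p'"
proof (rule ccontr)
  have less: "pmf r' s < pmf r s" if "r \<noteq> r'" "is_stationary S K r" "is_stationary S K r'" for r r'
  proof -
    from pmf_neq_exists_less[of r' r] that obtain x where x: "pmf r' x < pmf r x" by auto
    then have "x \<in> set_pmf r" by (metis less_le_not_le pmf_eq_0_set_pmf pmf_nonneg)
    then have "x \<in> S" using that by (auto simp: is_stationary_def)
    then show ?thesis
      using stationary_mono_reach[OF _ _ reach[of x] x] that by (simp add: is_stationary_def)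
  qed
  assume "p \<noteq> p'"
  then show False using less[of p p'] less[of p' p] assms(2,3) by simp
qed

subsection \<open>Stationarity of the product weights\<close>

definition holes_below :: "nat set \<Rightarrow> nat \<Rightarrow> nat" where
  "holes_below B x = card ({..<x} - B)"

definition jep_weight :: "(nat \<Rightarrow> real) \<Rightarrow> nat set \<Rightarrow> real" where
  "jep_weight F B = (\<Prod>x\<in>B. F (holes_below B x))"

text \<open>As \<open>theta Y\<close> is increasing, the free heights below \<open>theta Y k\<close>
  are the images of \<open>{..<k}\<close>. Hence \<open>holes_below\<close> recovers the throw value
  that lands at a given free height.\<close>

lemma theta_holes_below:
  assumes "finite Y" "y \<notin> Y"
  shows "theta Y (holes_below Y y) = y"
proof -
  note th = theta_order_bijection[OF assms(1)]
  have "y \<in> range (theta Y)"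
    using assms(2) th(2) by (simp add: bij_betw_def)
  then obtain k where k: "y = theta Y k" by blast
  have "{..<y} - Y = theta Y ` {..<k}"
  proof (intro set_eqI iffI)
    fix z assume z: "z \<in> {..<y} - Y"
    then have "z \<in> range (theta Y)" using th(2) by (simp add: bij_betw_def)
    then obtain j where "z = theta Y j" by blast
    with z k show "z \<in> theta Y ` {..<k}" using strict_mono_less[OF th(1)] by auto
  next
    fix z assume "z \<in> theta Y ` {..<k}"
    then obtain j where j: "z = theta Y j" "j < k" by blast
    then have "z \<in> - Y" using th(2) by (auto simp: bij_betw_def)
    with j k show "z \<in> {..<y} - Y" using strict_mono_less[OF th(1)] by auto
  qed
  then have "holes_below Y y = card {..<k}"
    unfolding holes_below_def
    using strict_mono_imp_inj_on[OF th(1)] by (metis card_image inj_on_subset subset_UNIV)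
  then show ?thesis using k by simp
qed

lemma theta_0_le_card:
  assumes "finite Y"
  shows "theta Y 0 \<le> card Y" "theta Y 0 = card Y \<Longrightarrow> Y = {..<card Y}"
proof -
  have sub: "{..<theta Y 0} \<subseteq> Y"
  proof
    fix z assume z: "z \<in> {..<theta Y 0}"
    show "z \<in> Y"
    proof (rule ccontr)
      assume "z \<notin> Y"
      then have "theta Y 0 \<le> z"
        by (metis theta_holes_below[OF assms] strict_mono_less_eq[OF theta_order_bijection(1)[OF assms]] zero_le)
      with z show False by simp
    qed
  qed
  then show "theta Y 0 \<le> card Y"
    using card_mono[OF assms sub] by simp
  show "Y = {..<card Y}" if "theta Y 0 = card Y"
    using card_subset_eq[OF assms sub] that by simp
qed

lemma shift_down_Suc_image [simp]: "shift_down (Suc ` B) = B"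
  by (auto simp: shift_down_def image_image)

lemma Suc_image_shift_down:
  assumes "0 \<notin> X"
  shows "Suc ` shift_down X = X"
proof -
  have "Suc (x - 1) = x" if "x \<in> X" for x
    using assms that by (cases x) auto
  then show ?thesis by (simp add: shift_down_def image_image)
qed

text \<open>Shifting up opens a hole at \<open>0\<close>, below every shifted particle. In the next
  lemma that hole is filled, so the counts stay as they were.\<close>

lemma holes_below_Suc_image: "holes_below (Suc ` B) (Suc x) = Suc (holes_below B x)"
proof -
  have "{..<Suc x} - Suc ` B = insert 0 (Suc ` ({..<x} - B))"
    unfolding lessThan_Suc_eq_insert_0 by auto
  then show ?thesis by (simp add: holes_below_def card_image)
qed

lemma holes_below_insert_0_Suc_image: "holes_below (insert 0 (Suc ` B)) (Suc x) = holes_below B x"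
proof -
  have "{..<Suc x} - insert 0 (Suc ` B) = Suc ` ({..<x} - B)"
    unfolding lessThan_Suc_eq_insert_0 by auto
  then show ?thesis by (simp add: holes_below_def card_image)
qed

lemma holes_below_remove:
  assumes "y \<in> B"
  shows "holes_below (B - {y}) x = (if y < x then Suc (holes_below B x) else holes_below B x)"
proof -
  have "{..<x} - (B - {y}) = (if y < x then insert y ({..<x} - B) else {..<x} - B)"
    using assms by auto
  then show ?thesis using assms by (auto simp: holes_below_def)
qed

lemma holes_below_0 [simp]: "holes_below B 0 = 0"
  by (simp add: holes_below_def)

lemma jep_weight_Suc_image: "jep_weight F (Suc ` B) = (\<Prod>x\<in>B. F (Suc (holes_below B x)))"
  by (simp add: jep_weight_def prod.reindex holes_below_Suc_image)

text \<open>The set on the left is the state from which a throw landing at \<open>y\<close> produces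
  \<open>B\<close>. Taking \<open>y\<close> out gives the particles above it one more hole and does
  not affect those below; the particle at \<open>0\<close> contributes
  \<open>F 0 = 1\<close>.\<close>

lemma jep_weight_throw:
  assumes "finite B" "y \<in> B" "F 0 = 1"
  shows "jep_weight F (insert 0 (Suc ` (B - {y}))) =
    (\<Prod>x\<in>B \<inter> {..<y}. F (holes_below B x)) * (\<Prod>x\<in>B \<inter> {y<..}. F (Suc (holes_below B x)))"
proof -
  let ?h = "\<lambda>x. F (holes_below (B - {y}) x)"
  have "jep_weight F (insert 0 (Suc ` (B - {y}))) = prod ?h (B - {y})"
    using assms(1,3)
    by (simp add: jep_weight_def prod.reindex holes_below_insert_0_Suc_image)
  also have "\<dots> = prod ?h (B \<inter> {..<y} \<union> B \<inter> {y<..})"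
    by (rule prod.cong) auto
  also have "\<dots> = prod ?h (B \<inter> {..<y}) * prod ?h (B \<inter> {y<..})"
    using assms(1) by (intro prod.union_disjoint) auto
  also have "\<dots> = (\<Prod>x\<in>B \<inter> {..<y}. F (holes_below B x)) * (\<Prod>x\<in>B \<inter> {y<..}. F (Suc (holes_below B x)))"
    using assms(2) by (intro arg_cong2[where f = "(*)"] prod.cong) (auto simp: holes_below_remove)
  finally show ?thesis .
qed

text \<open>The summand at \<open>y\<close> is a difference of two mixed products: \<open>f\<close>
  up to and including \<open>y\<close>, or only strictly below \<open>y\<close>, and
  \<open>g\<close> on the rest. Neighbouring mixed products cancel.\<close>

lemma prod_telescope:
  fixes f g :: "'a :: linorder \<Rightarrow> 'b :: comm_ring_1"
  assumes "finite B"
  shows "(\<Sum>y\<in>B. prod f (B \<inter> {..<y}) * prod g (B \<inter> {y<..}) * (f y - g y)) = prod f B - prod g B"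
  using assms
proof (induction B rule: finite_linorder_max_induct)
  case (insert b A)
  have A: "insert b A \<inter> {..<y} = A \<inter> {..<y}" "insert b A \<inter> {y<..} = insert b (A \<inter> {y<..})" if "y \<in> A" for y
    using insert.hyps that by (auto dest: bspec)
  have b: "insert b A \<inter> {..<b} = A" "insert b A \<inter> {b<..} = {}"
    using insert.hyps by (auto dest: less_asym)
  have "b \<notin> A" using insert.hyps by auto
  have "(\<Sum>y\<in>insert b A. prod f (insert b A \<inter> {..<y}) * prod g (insert b A \<inter> {y<..}) * (f y - g y))
     = prod f A * (f b - g b) +
       (\<Sum>y\<in>A. prod f (insert b A \<inter> {..<y}) * prod g (insert b A \<inter> {y<..}) * (f y - g y))"
    using insert.hyps \<open>b \<notin> A\<close> by (simp add: b)
  also have "(\<Sum>y\<in>A. prod f (insert b A \<inter> {..<y}) * prod g (insert b A \<inter> {y<..}) * (f y - g y))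
     = (\<Sum>y\<in>A. g b * (prod f (A \<inter> {..<y}) * prod g (A \<inter> {y<..}) * (f y - g y)))"
    using insert.hyps(1) \<open>b \<notin> A\<close> by (intro sum.cong refl) (simp add: A mult_ac)
  also have "\<dots> = g b * (prod f A - prod g A)"
    by (simp add: insert.IH flip: sum_distrib_left)
  finally show ?case using insert.hyps(1) \<open>b \<notin> A\<close> by (simp add: algebra_simps)
qed simp

text \<open>When \<open>F\<close> is the tail of the throw distribution, the last factor is the
  probability of landing at \<open>y\<close>. Telescoping is applied between the factors of
  \<open>B\<close> and those of the shifted state.\<close>

lemma jep_weight_balance:
  assumes "finite B" "F 0 = 1"
  shows "jep_weight F B = jep_weight F (Suc ` B) +
    (\<Sum>y\<in>B. jep_weight F (insert 0 (Suc ` (B - {y}))) *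
       (F (holes_below B y) - F (Suc (holes_below B y))))"
  using prod_telescope[OF assms(1), of "\<lambda>x. F (holes_below B x)" "\<lambda>x. F (Suc (holes_below B x))"]
  by (simp add: jep_weight_throw assms jep_weight_Suc_image) (simp add: jep_weight_def)

lemma jep_step_Suc_image: "jep_step xi (Suc ` B) = return_pmf B"
  by (simp add: jep_step_def)

lemma jep_step_throw:
  "jep_step xi (insert 0 (Suc ` Y)) = map_pmf (\<lambda>x. insert (theta Y x) Y) xi"
proof -
  have "insert 0 (Suc ` Y) - {0} = Suc ` Y" by auto
  then show ?thesis by (simp add: jep_step_def Let_def)
qed

lemma jep_step_throw_ge:
  assumes "finite B" "y \<in> B"
  shows "pmf xi (holes_below B y) \<le> pmf (jep_step xi (insert 0 (Suc ` (B - {y})))) B"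
proof -
  have "theta (B - {y}) (holes_below B y) = y"
    using theta_holes_below[of "B - {y}" y] holes_below_remove[OF assms(2), of y] assms(1) by simp
  then have "{holes_below B y} \<subseteq> (\<lambda>x. insert (theta (B - {y}) x) (B - {y})) -` {B}"
    using assms(2) by auto
  then show ?thesis
    unfolding jep_step_throw pmf_map
    by (subst measure_pmf_single[symmetric]) (rule measure_pmf.finite_measure_mono, simp_all)
qed

lemma pmf_eq_if_le:
  assumes "\<And>x. pmf p x \<le> pmf p' x"
  shows "p = p'"
  using pmf_neq_exists_less[of p' p] assms by (auto simp: not_less[symmetric])

text \<open>
  Only the predecessors that contribute to the balance equation are needed: they give
  \<open>p \<le> p K\<close>, and two probability distributions that are pointwise ordered coincide.
\<close>

lemma stationary_jep_weight:
  assumes F: "F 0 = 1" "\<And>s. pmf xi s = F s - F (Suc s)"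
    and p: "\<And>B. pmf p B = (if B \<in> nsets UNIV n then jep_weight F B / Z else 0)"
  shows "bind_pmf p (jep_step xi) = p"
proof -
  have "pmf p B \<le> pmf (bind_pmf p (jep_step xi)) B" for B
  proof (cases "B \<in> nsets UNIV n")
    case True
    then have B: "finite B" "card B = n" by (auto simp: nsets_def)
    let ?throw = "\<lambda>y. insert 0 (Suc ` (B - {y}))"
    let ?A = "insert (Suc ` B) (?throw ` B)"
    \<comment> \<open>Different landing heights have different predecessors, and the shifted set is
      none of these since it lacks \<open>0\<close>. So the sum over \<open>?A\<close> counts no
      state twice.\<close>
    have inj: "inj_on ?throw B"
    proof (rule inj_onI)
      fix y z assume yz: "y \<in> B" "z \<in> B" "?throw y = ?throw z"
      then have "Suc y \<notin> ?throw z" by (metis (no_types, lifting) DiffE imageE insert_iff nat.distinct(1) nat.inject singletonI)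
      with yz show "y = z" by auto
    qed
    have notin: "Suc ` B \<notin> ?throw ` B" by auto
    have pS: "pmf p (Suc ` B) = jep_weight F (Suc ` B) / Z"
      using B by (simp add: p nsets_def card_image)
    have pT: "pmf p (?throw y) = jep_weight F (?throw y) / Z" if "y \<in> B" for y
    proof -
      have "card (?throw y) = Suc (card (B - {y}))"
        using B by (subst card_insert_disjoint) (auto simp: card_image)
      also have "\<dots> = n" using B that by (metis card_Suc_Diff1)
      finally show ?thesis using B by (simp add: p nsets_def)
    qed
    have "pmf p B = jep_weight F B / Z" using True by (simp add: p)
    also have "\<dots> = pmf p (Suc ` B) + (\<Sum>y\<in>B. pmf p (?throw y) * pmf xi (holes_below B y))"
      by (subst jep_weight_balance[of B F, OF B(1) F(1)])
         (simp add: pS pT F(2) add_divide_distrib sum_divide_distrib)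
    also have "\<dots> \<le> pmf p (Suc ` B) * pmf (jep_step xi (Suc ` B)) B +
        (\<Sum>y\<in>B. pmf p (?throw y) * pmf (jep_step xi (?throw y)) B)"
      by (intro add_mono sum_mono mult_left_mono jep_step_throw_ge B)
         (auto simp: jep_step_Suc_image)
    also have "\<dots> = (\<Sum>X\<in>?A. pmf p X * pmf (jep_step xi X) B)"
      using B notin inj by (simp add: sum.reindex)
    also have "\<dots> = (\<integral>X. pmf (jep_step xi X) B * indicator ?A X \<partial>measure_pmf p)"
      using B by (subst integral_measure_pmf[of ?A]) (auto intro!: sum.cong simp: indicator_def)
    also have "\<dots> \<le> (\<integral>X. pmf (jep_step xi X) B \<partial>measure_pmf p)"
      by (intro integral_mono measure_pmf.integrable_const_bound[where B = 1])
         (auto simp: pmf_le_1 indicator_def)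
    finally show ?thesis by (simp add: pmf_bind)
  qed (simp add: p)
  then show ?thesis using pmf_eq_if_le by metis
qed

text \<open>A throw to the lowest free height decreases the sum of the heights unless \<open>X = {..<n}\<close>.\<close>

lemma jep_reach:
  assumes "0 \<in> set_pmf xi" "0 < n" "X \<in> nsets UNIV n"
  shows "(X, {..<n}) \<in> {(X, Y). Y \<in> set_pmf (jep_step xi X)}\<^sup>*"
  using assms(3)
proof (induction "\<Sum>X" arbitrary: X rule: less_induct)
  case less
  then have X: "finite X" "card X = n" by (auto simp: nsets_def)
  show ?case
  proof (cases "0 \<in> X")
    case False
    define B where "B = shift_down X"
    have XB: "X = Suc ` B" using Suc_image_shift_down[OF False] by (simp add: B_def)
    then have B: "finite B" "card B = n" using X by (auto simp: card_image finite_image_iff)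
    have "\<Sum>X = \<Sum>B + n" using B sum_Suc[of "\<lambda>x. x" B] by (simp add: XB sum.reindex)
    then have "\<Sum>B < \<Sum>X" using assms(2) by simp
    then have "(B, {..<n}) \<in> {(X, Y). Y \<in> set_pmf (jep_step xi X)}\<^sup>*"
      using B by (intro less.hyps) (auto simp: nsets_def)
    moreover have "B \<in> set_pmf (jep_step xi X)" by (simp add: XB jep_step_Suc_image)
    ultimately show ?thesis by (auto intro: converse_rtrancl_into_rtrancl)
  next
    case True
    define Y where "Y = shift_down (X - {0})"
    have "X = insert 0 (Suc ` Y)"
      using Suc_image_shift_down[of "X - {0}"] True by (auto simp: Y_def)
    then have XY: "X = insert 0 (Suc ` Y)" .
    then have Y: "finite Y" "n = Suc (card Y)"
      using X by (auto simp: card_insert_if card_image finite_image_iff)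
    define B where "B = insert (theta Y 0) Y"
    have "theta Y 0 \<notin> Y" using theta_order_bijection(2)[OF Y(1)] by (auto simp: bij_betw_def)
    then have B: "finite B" "card B = n" "\<Sum>B = theta Y 0 + \<Sum>Y" using Y by (auto simp: B_def)
    have mem: "B \<in> set_pmf (jep_step xi X)" using assms(1) by (auto simp: XY jep_step_throw B_def)
    \<comment> \<open>Compared with \<open>\<Sum>B = theta Y 0 + \<Sum>Y\<close>, the sum drops
      exactly when \<open>theta Y 0 < card Y\<close>; the remaining case is the packed
      state.\<close>
    have sumX: "\<Sum>X = card Y + \<Sum>Y"
      using Y(1) sum_Suc[of "\<lambda>x. x" Y] by (simp add: XY sum.reindex)
    show ?thesis
    proof (cases "theta Y 0 = card Y")
      case True
      then have "Y = {..<card Y}" using theta_0_le_card[OF Y(1)] by blast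
      then have "X = {..<n}" using XY Y(2) by (metis lessThan_Suc_eq_insert_0)
      then show ?thesis by simp
    next
      case False
      then have "theta Y 0 < card Y" using theta_0_le_card(1)[OF Y(1)] by simp
      then have "(B, {..<n}) \<in> {(X, Y). Y \<in> set_pmf (jep_step xi X)}\<^sup>*"
        using B sumX by (intro less.hyps) (auto simp: nsets_def)
      with mem show ?thesis by (auto intro: converse_rtrancl_into_rtrancl)
    qed
  qed
qed

section \<open>Stationary distributions as normalised weights\<close>

lemma pmf_of_summable:
  fixes f :: "'a \<Rightarrow> real"
  assumes "\<And>x. x \<in> A \<Longrightarrow> 0 \<le> f x" "f summable_on A" "infsum f A = 1"
  obtains p where "\<And>x. pmf p x = (if x \<in> A then f x else 0)"
proof -
  let ?g = "\<lambda>x. if x \<in> A then f x else 0"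
  have abs: "Infinite_Set_Sum.abs_summable_on f A"
    using assms(1,2) summable_on_cong[of A "\<lambda>x. norm (f x)" f]
    by (simp flip: abs_summable_equivalent)
  have "(\<integral>\<^sup>+x. ennreal (?g x) \<partial>count_space UNIV) = (\<integral>\<^sup>+x. ennreal (f x) \<partial>count_space A)"
    by (subst nn_integral_count_space_indicator) (auto intro!: nn_integral_cong)
  also have "\<dots> = 1"
    using abs assms by (simp add: nn_integral_conv_infsetsum infsetsum_infsum)
  finally have "pmf (embed_pmf ?g) x = ?g x" for x
    using assms(1) by (intro pmf_embed_pmf) auto
  then show thesis by (rule that)
qed

lemma jep_weight_nonneg:
  assumes "\<And>s. 0 \<le> F s"
  shows "0 \<le> jep_weight F B"
  unfolding jep_weight_def using assms by (intro prod_nonneg) auto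

text \<open>Existence comes from the balance equation, uniqueness from reachability of
  \<open>{..<n}\<close>: \<open>F 1 < 1\<close> gives the throw \<open>0\<close> positive
  probability. The parameter \<open>S\<close> lets one statement serve both chains.\<close>

lemma stationary_pmf_jep:
  assumes F: "F 0 = 1" "\<And>s. 0 \<le> F s" "\<And>s. pmf xi s = F s - F (Suc s)" "F 1 < 1"
    and n: "0 < n" and summ: "jep_weight F summable_on nsets UNIV n"
    and S: "S \<subseteq> nsets UNIV n" "\<And>B. B \<in> nsets UNIV n \<Longrightarrow> B \<notin> S \<Longrightarrow> jep_weight F B = 0"
  shows "pmf (stationary_pmf S (jep_step xi)) B =
    (if B \<in> nsets UNIV n then jep_weight F B / infsum (jep_weight F) (nsets UNIV n) else 0)"
    and "0 < infsum (jep_weight F) (nsets UNIV n)"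
proof -
  let ?Z = "infsum (jep_weight F) (nsets UNIV n)"
  \<comment> \<open>The packed state has weight \<open>1\<close>, which keeps the normalising
    constant away from \<open>0\<close>.\<close>
  have "holes_below {..<n} x = 0" if "x < n" for x
  proof -
    have "{..<x} - {..<n} = {}" using that by auto
    then show ?thesis by (simp add: holes_below_def)
  qed
  then have "jep_weight F {..<n} = 1" by (simp add: jep_weight_def F(1))
  then have "1 \<le> ?Z"
    using finite_sum_le_infsum[OF summ, of "{{..<n}}"] jep_weight_nonneg[of F] F(2)
    by (simp add: nsets_def)
  then show Z: "0 < ?Z" by simp
  have "infsum (\<lambda>B. jep_weight F B / ?Z) (nsets UNIV n) = 1"
    using Z by (simp add: divide_inverse infsum_cmult_left')
  moreover have "(\<lambda>B. jep_weight F B / ?Z) summable_on nsets UNIV n"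
    using summ by (simp add: divide_inverse summable_on_cmult_left)
  ultimately obtain p where
    p: "\<And>B. pmf p B = (if B \<in> nsets UNIV n then jep_weight F B / ?Z else 0)"
    using pmf_of_summable[of "nsets UNIV n" "\<lambda>B. jep_weight F B / ?Z"] jep_weight_nonneg[of F] F(2) Z
    by (metis divide_nonneg_pos)
  have "set_pmf p \<subseteq> S"
  proof
    fix B assume "B \<in> set_pmf p"
    then have "B \<in> nsets UNIV n" "jep_weight F B \<noteq> 0"
      by (auto simp: set_pmf_iff p split: if_splits)
    then show "B \<in> S" using S(2) by blast
  qed
  then have stat: "is_stationary S (jep_step xi) p"
    using stationary_jep_weight[OF F(1,3) p] by (simp add: is_stationary_def)
  have "0 \<in> set_pmf xi" using F by (simp add: set_pmf_iff)
  then have "stationary_pmf S (jep_step xi) = p"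
    unfolding stationary_pmf_def
    using stationary_unique[of S "{..<n}" "jep_step xi"] jep_reach[of xi n] n S(1) stat
    by (intro the_equality) blast+
  then show "pmf (stationary_pmf S (jep_step xi)) B =
    (if B \<in> nsets UNIV n then jep_weight F B / ?Z else 0)"
    by (simp add: p)
qed

subsection \<open>Complete homogeneous symmetric polynomials\<close>

text \<open>
  \<open>hsym x N n\<close> is the complete homogeneous symmetric polynomial of degree \<open>n\<close> in
  \<open>x 0, \<dots>, x (N - 1)\<close>.
\<close>

fun hsym :: "(nat \<Rightarrow> real) \<Rightarrow> nat \<Rightarrow> nat \<Rightarrow> real" where
  "hsym x N 0 = 1"
| "hsym x 0 (Suc n) = 0"
| "hsym x (Suc N) (Suc n) = hsym x N (Suc n) + x N * hsym x (Suc N) n"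

lemma hsym_nonneg:
  assumes "\<And>i. i < N \<Longrightarrow> 0 \<le> x i"
  shows "0 \<le> hsym x N n"
  using assms by (induction x N n rule: hsym.induct) auto

lemma hsym_mono:
  assumes "\<And>i. i < N \<Longrightarrow> 0 \<le> x i" "\<And>i. i < N \<Longrightarrow> x i \<le> y i"
  shows "hsym x N n \<le> hsym y N n"
  using assms
proof (induction x N n rule: hsym.induct)
  case (3 x N n)
  have "x N * hsym x (Suc N) n \<le> y N * hsym y (Suc N) n"
    using 3 by (intro mult_mono hsym_nonneg) (auto intro: order_trans)
  then show ?case using 3 by auto
qed auto

text \<open>A first-order bound: the partial derivatives of \<open>h_{n+1}\<close> in
  \<open>N\<close> variables add up to \<open>(N + n) h_n\<close>, and \<open>h_n\<close> only
  decreases under the shift. The proof is an induction along the recursion, on \<open>N\<close>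
  outside and \<open>n\<close> inside.\<close>

lemma hsym_shift_lower:
  assumes "0 \<le> c" "\<And>i. i < N \<Longrightarrow> c \<le> x i"
  shows "hsym x N (Suc n) - real (N + n) * c * hsym x N n \<le> hsym (\<lambda>i. x i - c) N (Suc n)"
  using assms(2)
proof (induction N arbitrary: n)
  case 0
  then show ?case using \<open>0 \<le> c\<close> by (cases n) auto
next
  case (Suc N)
  note outer = Suc
  have nn: "0 \<le> x N - c" using Suc.prems by auto
  let ?y = "\<lambda>i. x i - c"
  show ?case
  proof (induction n)
    case 0
    have "hsym x N (Suc 0) - real N * c \<le> hsym ?y N (Suc 0)"
      using outer(1)[of 0] outer(2) by simp
    then show ?case by (simp add: algebra_simps)
  next
    case (Suc n)
    have A: "hsym x N (Suc (Suc n)) - real (N + Suc n) * c * hsym x N (Suc n) \<le> hsym ?y N (Suc (Suc n))"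
      using outer(1)[of "Suc n"] outer(2) by simp
    have B: "hsym ?y (Suc N) (Suc n) \<le> hsym x (Suc N) (Suc n)"
      using assms(1) outer(2) by (intro hsym_mono) auto
    have C: "x N * (hsym x (Suc N) (Suc n) - real (Suc N + n) * c * hsym x (Suc N) n)
        \<le> x N * hsym ?y (Suc N) (Suc n)"
      using Suc nn assms(1) by (intro mult_left_mono) auto
    have D: "c * hsym ?y (Suc N) (Suc n) \<le> c * hsym x (Suc N) (Suc n)"
      using B assms(1) by (rule mult_left_mono)
    have "hsym ?y (Suc N) (Suc (Suc n))
      = hsym ?y N (Suc (Suc n)) + x N * hsym ?y (Suc N) (Suc n) - c * hsym ?y (Suc N) (Suc n)"
      by (simp add: algebra_simps)
    \<comment> \<open>The two terms with coefficient \<open>N + n + 1\<close> recombine by the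
      recursion, and the last term raises that coefficient by one.\<close>
    also have "\<dots> \<ge> (hsym x N (Suc (Suc n)) - real (N + Suc n) * c * hsym x N (Suc n))
       + x N * (hsym x (Suc N) (Suc n) - real (Suc N + n) * c * hsym x (Suc N) n)
       - c * hsym x (Suc N) (Suc n)"
      using A C D by linarith
    also have "(hsym x N (Suc (Suc n)) - real (N + Suc n) * c * hsym x N (Suc n))
       + x N * (hsym x (Suc N) (Suc n) - real (Suc N + n) * c * hsym x (Suc N) n)
       - c * hsym x (Suc N) (Suc n)
      = hsym x (Suc N) (Suc (Suc n)) - real (Suc N + Suc n) * c * hsym x (Suc N) (Suc n)"
      by (simp add: algebra_simps)
    finally show ?case .
  qed
qed

text \<open>The Gaussian binomial formula with denominators cleared; the induction step is the
  q-Pascal rule. For \<open>N = 0\<close> and positive degree the factor at \<open>j = 0\<close>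
  vanishes.\<close>

lemma hsym_geometric:
  fixes q :: real
  shows "hsym (\<lambda>i. q ^ i) N n * (\<Prod>j<n. 1 - q ^ Suc j) = (\<Prod>j<n. 1 - q ^ (N + j))"
proof (induction "\<lambda>i. q ^ i" N n rule: hsym.induct)
  case (2 n)
  then show ?case by (simp add: prod.lessThan_Suc_shift del: prod.lessThan_Suc)
next
  case (3 N n)
  let ?P = "\<lambda>n. \<Prod>j<n. 1 - q ^ Suc j"
  let ?A = "\<Prod>j<n. 1 - q ^ (Suc N + j)"
  have "hsym (\<lambda>i. q ^ i) (Suc N) (Suc n) * ?P (Suc n)
      = hsym (\<lambda>i. q ^ i) N (Suc n) * ?P (Suc n)
        + q ^ N * (1 - q ^ Suc n) * (hsym (\<lambda>i. q ^ i) (Suc N) n * ?P n)"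
    by (simp add: algebra_simps)
  also have "\<dots> = (\<Prod>j<Suc n. 1 - q ^ (N + j)) + q ^ N * (1 - q ^ Suc n) * ?A"
    using 3 by simp
  also have "(\<Prod>j<Suc n. 1 - q ^ (N + j)) = (1 - q ^ N) * ?A"
    by (subst prod.lessThan_Suc_shift) simp
  also have "(1 - q ^ N) * ?A + q ^ N * (1 - q ^ Suc n) * ?A = ?A * (1 - q ^ (Suc N + n))"
    by (simp add: algebra_simps power_add)
  finally show ?case by simp
qed auto

subsection \<open>Normalising constants\<close>

lemma holes_below_insert_greater:
  assumes "x \<le> m"
  shows "holes_below (insert m B) x = holes_below B x"
proof -
  have "{..<x} - insert m B = {..<x} - B" using assms by auto
  then show ?thesis by (simp add: holes_below_def)
qed

text \<open>Split by whether the top height \<open>m\<close> is occupied. A particle there has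
  \<open>m - k\<close> holes below it and changes no other count, which reproduces the recursion of
  \<open>hsym\<close>.\<close>

lemma sum_jep_weight_nsets:
  "(\<Sum>B\<in>nsets {..<m} n. jep_weight F B) = hsym F (Suc m - n) n"
proof (induction m arbitrary: n)
  case 0
  then show ?case by (cases n) (simp_all add: nsets_zero nsets_empty_iff jep_weight_def)
next
  case (Suc m)
  show ?case
  proof (cases n)
    case 0
    then show ?thesis by (simp add: nsets_zero jep_weight_def)
  next
    case (Suc k)
    have split: "nsets {..<Suc m} (Suc k) = nsets {..<m} (Suc k) \<union> insert m ` nsets {..<m} k"
    proof (intro set_eqI iffI)
      fix B assume B: "B \<in> nsets {..<Suc m} (Suc k)"
      show "B \<in> nsets {..<m} (Suc k) \<union> insert m ` nsets {..<m} k"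
      proof (cases "m \<in> B")
        case True
        then have "B - {m} \<in> nsets {..<m} k" "B = insert m (B - {m})"
          using B by (auto simp: nsets_def lessThan_Suc)
        then show ?thesis by blast
      next
        case False
        then show ?thesis using B by (auto simp: nsets_def lessThan_Suc)
      qed
    qed (auto simp: nsets_def lessThan_Suc card_insert_if)
    have inj: "inj_on (insert m) (nsets {..<m} k)"
    proof (rule inj_onI)
      fix A B assume "A \<in> nsets {..<m} k" "B \<in> nsets {..<m} k" "insert m A = insert m B"
      moreover from this have "m \<notin> A" "m \<notin> B" by (auto simp: nsets_def)
      ultimately show "A = B" by (simp add: insert_ident)
    qed
    have weight: "jep_weight F (insert m B) = F (m - k) * jep_weight F B"
      if "B \<in> nsets {..<m} k" for B
    proof -
      from that have B: "B \<subseteq> {..<m}" "finite B" "card B = k" "m \<notin> B" by (auto simp: nsets_def)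
      have "holes_below (insert m B) m = m - k"
        using B by (simp add: holes_below_insert_greater) (simp add: holes_below_def card_Diff_subset)
      moreover have "holes_below (insert m B) x = holes_below B x" if "x \<in> B" for x
        using B that by (intro holes_below_insert_greater) auto
      ultimately show ?thesis using B by (simp add: jep_weight_def)
    qed
    have "(\<Sum>B\<in>nsets {..<Suc m} (Suc k). jep_weight F B)
        = (\<Sum>B\<in>nsets {..<m} (Suc k). jep_weight F B) + (\<Sum>B\<in>insert m ` nsets {..<m} k. jep_weight F B)"
      unfolding split
      by (rule sum.union_disjoint) (auto simp: finite_imp_finite_nsets nsets_def)
    also have "(\<Sum>B\<in>insert m ` nsets {..<m} k. jep_weight F B)
        = F (m - k) * (\<Sum>B\<in>nsets {..<m} k. jep_weight F B)"
      using inj weight by (simp add: sum.reindex sum_distrib_left)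
    finally have "(\<Sum>B\<in>nsets {..<Suc m} (Suc k). jep_weight F B)
        = hsym F (m - k) (Suc k) + F (m - k) * hsym F (Suc m - k) k"
      using Suc.IH by simp
    also have "\<dots> = hsym F (Suc m - k) (Suc k)"
    proof (cases "k \<le> m")
      case True
      then show ?thesis by (simp add: Suc_diff_le)
    next
      \<comment> \<open>Here truncated subtraction leaves no variables and \<open>k\<close> is
        positive, so both sides vanish.\<close>
      case False
      then show ?thesis by (cases k) simp_all
    qed
    finally show ?thesis using Suc by simp
  qed
qed

lemma jep_weight_mono:
  assumes "\<And>s. 0 \<le> F s" "\<And>s. F s \<le> G s"
  shows "jep_weight F B \<le> jep_weight G B"
  unfolding jep_weight_def using assms by (intro prod_mono) auto

lemma finite_nsets_UNIV_bound:
  assumes "finite \<B>" "\<B> \<subseteq> nsets UNIV n"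
  obtains m :: nat where "\<B> \<subseteq> nsets {..<m} n"
proof -
  have "finite (\<Union>\<B>)" using assms by (auto simp: nsets_def)
  then obtain m where "\<Union>\<B> \<subseteq> {..<m}" using finite_nat_bounded by blast
  then have "\<B> \<subseteq> nsets {..<m} n" using assms by (auto simp: nsets_def)
  then show thesis by (rule that)
qed

text \<open>Each finite family of states lies below some height \<open>m\<close>, where the
  partition function is a Gaussian binomial whose numerator is at most \<open>1\<close>. The
  resulting bound does not depend on \<open>m\<close>.\<close>

lemma jep_weight_geometric_summable:
  fixes q :: real
  assumes "0 < q" "q < 1"
  shows "jep_weight (\<lambda>s. q ^ s) summable_on nsets UNIV n"
    and "infsum (jep_weight (\<lambda>s. q ^ s)) (nsets UNIV n) * (\<Prod>j<n. 1 - q ^ Suc j) \<le> 1"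
proof -
  let ?W = "jep_weight (\<lambda>s. q ^ s)" and ?P = "\<Prod>j<n. 1 - q ^ Suc j"
  have nn: "0 \<le> ?W B" for B using assms by (intro jep_weight_nonneg) auto
  have P: "0 < ?P" using assms by (intro prod_pos) (auto simp: power_less_one_iff simp del: power_Suc)
  have bound: "sum ?W \<B> \<le> 1 / ?P" if fin: "finite \<B>" "\<B> \<subseteq> nsets UNIV n" for \<B>
  proof -
    obtain m where m: "\<B> \<subseteq> nsets {..<m} n" by (rule finite_nsets_UNIV_bound[OF fin])
    have "sum ?W \<B> \<le> sum ?W (nsets {..<m} n)"
      using m nn by (intro sum_mono2) (auto simp: finite_imp_finite_nsets)
    also have "\<dots> = hsym (\<lambda>s. q ^ s) (Suc m - n) n" by (rule sum_jep_weight_nsets)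
    also have "\<dots> = (\<Prod>j<n. 1 - q ^ (Suc m - n + j)) / ?P"
      using hsym_geometric[of q "Suc m - n" n] P by (metis less_irrefl nonzero_eq_divide_eq)
    also have "\<dots> \<le> 1 / ?P"
      using P assms by (intro divide_right_mono prod_le_1) (auto simp: power_le_one)
    finally show ?thesis .
  qed
  show summ: "?W summable_on nsets UNIV n"
    using nn bound by (intro nonneg_bdd_above_summable_on) (auto simp: bdd_above_def)
  show "infsum ?W (nsets UNIV n) * ?P \<le> 1"
    using infsum_le_finite_sums[OF summ bound] P by (simp add: field_simps)
qed

section \<open>The tail function of the truncated geometric throw\<close>

definition trunc_tail :: "real \<Rightarrow> nat \<Rightarrow> nat \<Rightarrow> real" where
  "trunc_tail q l s = (if s < l then (q ^ s - q ^ l) / (1 - q ^ l) else 0)"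

text \<open>The upper bound uses \<open>q ^ (s + l) \<le> q ^ l\<close> and compares the two
  weights. The lower one drops a denominator below \<open>1\<close> and prepares the shift of all
  variables by \<open>q ^ l\<close>.\<close>

lemma trunc_tail_bounds:
  assumes "0 < q" "q < 1" "0 < l"
  shows "0 \<le> trunc_tail q l s" "trunc_tail q l s \<le> q ^ s"
    and "s < l \<Longrightarrow> q ^ s - q ^ l \<le> trunc_tail q l s"
proof -
  have ql: "0 < q ^ l" "q ^ l < 1" using assms by (auto simp: power_less_one_iff)
  have qs: "q ^ l \<le> q ^ s" if "s < l" using assms that by (intro power_decreasing) auto
  show "0 \<le> trunc_tail q l s" using ql qs by (auto simp: trunc_tail_def)
  have "q ^ s * q ^ l \<le> 1 * q ^ l" using assms ql by (intro mult_right_mono power_le_one) auto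
  then show "trunc_tail q l s \<le> q ^ s" using ql assms by (auto simp: trunc_tail_def field_simps)
  assume "s < l"
  then have "(q ^ s - q ^ l) * (1 - q ^ l) \<le> (q ^ s - q ^ l) * 1"
    using qs ql by (intro mult_left_mono) auto
  then show "q ^ s - q ^ l \<le> trunc_tail q l s"
    using ql \<open>s < l\<close> by (simp add: trunc_tail_def field_simps)
qed

lemma pmf_trunc_geometric_tail:
  assumes "0 < q" "q < 1" "0 < l"
  shows "pmf (trunc_geometric_pmf q l) s = trunc_tail q l s - trunc_tail q l (Suc s)"
proof -
  have ql: "1 - q ^ l \<noteq> 0" using power_less_one_iff[of q l] assms by auto
  consider "Suc s < l" | "l = Suc s" | "l \<le> s" by linarith
  then show ?thesis
  proof cases
    case 1
    then have "trunc_tail q l s - trunc_tail q l (Suc s) = (q ^ s - q ^ Suc s) / (1 - q ^ l)"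
      by (simp add: trunc_tail_def flip: diff_divide_distrib)
    then show ?thesis using 1 by (simp add: pmf_trunc_geometric assms algebra_simps)
  qed (use ql in \<open>simp_all add: pmf_trunc_geometric assms trunc_tail_def field_simps\<close>)
qed

text \<open>A particle at height at least \<open>m\<close> has at most \<open>n - 1\<close> others
  below it, hence at least \<open>m - n + 1\<close> holes, where the tail is
  \<open>0\<close>.\<close>

lemma jep_weight_trunc_tail_eq_0:
  assumes "B \<in> nsets UNIV n" "B \<notin> nsets {..<m} n" "n \<le> m"
  shows "jep_weight (trunc_tail q (m - n + 1)) B = 0"
proof -
  have B: "finite B" "card B = n" using assms(1) by (auto simp: nsets_def)
  then obtain x where x: "x \<in> B" "m \<le> x"
    using assms(2) by (auto simp: nsets_def subset_iff not_less)
  have "holes_below B x = card ({..<x} - (B - {x}))"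
    unfolding holes_below_def by (rule arg_cong[where f = card]) auto
  also have "\<dots> \<ge> x - card (B - {x})"
    using B diff_card_le_card_Diff[of "B - {x}" "{..<x}"] by simp
  finally have "m - n + 1 \<le> holes_below B x"
    using x B assms(3) card_gt_0_iff[of B] by auto
  then have "trunc_tail q (m - n + 1) (holes_below B x) = 0" by (simp add: trunc_tail_def)
  with x B show ?thesis unfolding jep_weight_def by (intro prod_zero) auto
qed

text \<open>The shift costs a factor \<open>1 - (l + n - 1) q^l\<close>, kept nonnegative by
  \<open>small\<close>, and the Gaussian numerator is at least \<open>1 - n q^l\<close> by the
  Weierstrass product inequality. Their product gives the bound.\<close>

lemma hsym_trunc_tail_lower:
  assumes q: "0 < q" "q < 1" and l: "0 < l" and n: "0 < n"
    and small: "real (l + n - 1) * q ^ l \<le> 1"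
  shows "1 - real (l + 2 * n) * q ^ l \<le> hsym (trunc_tail q l) l n * (\<Prod>j<n. 1 - q ^ Suc j)"
proof -
  define H where "H = hsym (\<lambda>s. q ^ s) l"
  define P where "P n = (\<Prod>j<n. 1 - q ^ Suc j)" for n
  have P: "0 < P n" for n
    unfolding P_def using q by (intro prod_pos) (auto simp: power_less_one_iff simp del: power_Suc)
  obtain k where k: "n = Suc k" using n gr0_implies_Suc by blast
  have H: "H j * P j = (\<Prod>i<j. 1 - q ^ (l + i))" for j
    unfolding H_def P_def by (rule hsym_geometric)
  \<comment> \<open>This is \<open>H k \<le> H n\<close> times \<open>P n\<close>, from
    \<open>Suc k \<le> l + k\<close>. It makes the loss in the shift proportional to
    \<open>H n\<close>.\<close>
  have "H k * P n \<le> (\<Prod>i<n. 1 - q ^ (l + i))"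
  proof -
    have "H k * P n = (\<Prod>i<k. 1 - q ^ (l + i)) * (1 - q ^ Suc k)"
      using H[of k] by (simp add: P_def k mult_ac)
    also have "\<dots> \<le> (\<Prod>i<k. 1 - q ^ (l + i)) * (1 - q ^ (l + k))"
      using q l by (intro mult_left_mono prod_nonneg diff_left_mono power_decreasing)
        (auto simp: power_le_one)
    finally show ?thesis by (simp add: k)
  qed
  then have Hk: "H k * P n \<le> H n * P n" by (simp add: H)
  let ?c = "q ^ l" and ?N = "real (l + n - 1)"
  have "H n - ?N * ?c * H k \<le> hsym (\<lambda>s. q ^ s - ?c) l n"
    using hsym_shift_lower[of ?c l "\<lambda>s. q ^ s" k] q k
    by (simp add: H_def power_decreasing)
  also have "\<dots> \<le> hsym (trunc_tail q l) l n"
    using q l trunc_tail_bounds(3)[of q l] by (intro hsym_mono) (auto simp: power_decreasing)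
  finally have "(H n - ?N * ?c * H k) * P n \<le> hsym (trunc_tail q l) l n * P n"
    using P[of n] by (intro mult_right_mono) auto
  moreover have "?N * ?c * (H k * P n) \<le> ?N * ?c * (H n * P n)"
    using Hk q by (intro mult_left_mono) auto
  ultimately have "(1 - ?N * ?c) * (H n * P n) \<le> hsym (trunc_tail q l) l n * P n"
    by (simp add: algebra_simps)
  moreover have "1 - real n * ?c \<le> H n * P n"
  proof -
    have "1 - real n * ?c \<le> 1 - (\<Sum>i<n. q ^ (l + i))"
      using sum_mono[of "{..<n}" "\<lambda>i. q ^ (l + i)" "\<lambda>_. ?c"] q by (simp add: power_decreasing)
    also have "\<dots> \<le> (\<Prod>i<n. 1 - q ^ (l + i))"
      using q by (intro Weierstrass_prod_ineq) (auto simp: power_le_one)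
    finally show ?thesis by (simp add: H)
  qed
  then have "(1 - ?N * ?c) * (1 - real n * ?c) \<le> (1 - ?N * ?c) * (H n * P n)"
    using small by (intro mult_left_mono) auto
  moreover have "1 - real (l + 2 * n) * ?c \<le> (1 - ?N * ?c) * (1 - real n * ?c)"
  proof -
    have "0 \<le> ?N * ?c * (real n * ?c)" using q by simp
    moreover have "?N * ?c \<le> (real l + real n) * ?c" using q l by (intro mult_right_mono) auto
    ultimately show ?thesis by (simp add: algebra_simps)
  qed
  ultimately show ?thesis unfolding P_def by linarith
qed

section \<open>The total variation bound and its limit\<close>

lemma tv_dist_bounded_unbounded_jep:
  assumes q: "0 < q" "q < 1" and nm: "1 \<le> n" "n \<le> m"
    and small: "real m * q ^ (m - n + 1) \<le> 1"
  shows "tv_dist (nsets UNIV n) (pi_bounded m n q) (pi_unbounded n q)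
    \<le> 3 * real m * q ^ (m - n + 1)"
    and "0 \<le> tv_dist (nsets UNIV n) (pi_bounded m n q) (pi_unbounded n q)"
proof -
  define l where "l = m - n + 1"
  have l: "0 < l" "l = Suc m - n" "l + n - 1 = m" using nm by (auto simp: l_def)
  let ?S = "nsets UNIV n :: nat set set"
  define W where "W = jep_weight (trunc_tail q l)"
  define U where "U = jep_weight (\<lambda>s. q ^ s)"
  define Z where "Z = infsum W ?S"
  define Y where "Y = infsum U ?S"
  have WU: "W B \<le> U B" and W0: "0 \<le> W B" for B
    unfolding W_def U_def using trunc_tail_bounds[OF q l(1)]
    by (auto intro!: jep_weight_mono jep_weight_nonneg)
  have U: "U summable_on ?S" and Y: "Y * (\<Prod>j<n. 1 - q ^ Suc j) \<le> 1"
    unfolding U_def Y_def by (rule jep_weight_geometric_summable[OF q])+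
  have W: "W summable_on ?S" using U WU W0 by (rule summable_on_comparison_test)
  have ql: "q ^ l < 1" "0 < q ^ l" using q l by (auto simp: power_less_one_iff)
  have n: "0 < n" using nm by simp
  have T0: "trunc_tail q l 0 = 1" using l(1) ql by (simp add: trunc_tail_def)
  have T1: "trunc_tail q l 1 < 1"
    using trunc_tail_bounds(2)[OF q l(1), of 1] q by simp
  have supp: "jep_weight (trunc_tail q l) B = 0" if "B \<in> ?S" "B \<notin> nsets {..<m} n" for B
    using jep_weight_trunc_tail_eq_0[OF that nm(2)] by (simp add: l_def)
  note b = stationary_pmf_jep[where F = "trunc_tail q l" and S = "nsets {..<m} n", OF T0 trunc_tail_bounds(1)[OF q l(1)]
      pmf_trunc_geometric_tail[OF q l(1)] T1 n W[unfolded W_def] nsets_mono[OF subset_UNIV] supp,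
      folded W_def, folded Z_def, unfolded l_def, folded bounded_jep_def, folded pi_bounded_def]
  have geom: "pmf (geometric_pmf (1 - q)) s = q ^ s - q ^ Suc s" for s
    using q by (simp add: algebra_simps)
  note u = stationary_pmf_jep[where F = "\<lambda>s. q ^ s", OF _ _ geom _ n U[unfolded U_def] subset_refl,
      folded U_def, folded Y_def unbounded_jep_def, folded pi_unbounded_def]
  have pb: "pmf (pi_bounded m n q) B = (if B \<in> ?S then W B / Z else 0)" for B
    using b(1) .
  have pu: "pmf (pi_unbounded n q) B = (if B \<in> ?S then U B / Y else 0)" for B
    using u(1) q by simp
  have Y0: "0 < Y" using u(2) q by simp
  have Z0: "0 < Z" using b(2) by blast
  let ?P = "\<Prod>j<n. 1 - q ^ Suc j"
  have P: "0 < ?P" using q by (intro prod_pos) (auto simp: power_less_one_iff simp del: power_Suc)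
  have ZY: "Z \<le> Y" unfolding Z_def Y_def using W U WU by (rule infsum_mono)
  have "hsym (trunc_tail q l) l n = sum W (nsets {..<m} n)"
    unfolding W_def l(2) by (rule sum_jep_weight_nsets[symmetric])
  also have "\<dots> \<le> Z"
    unfolding Z_def using W W0 by (intro finite_sum_le_infsum)
      (auto simp: finite_imp_finite_nsets nsets_def)
  finally have "hsym (trunc_tail q l) l n * ?P \<le> Z * ?P" using P by (intro mult_right_mono) auto
  moreover have "1 - real (l + 2 * n) * q ^ l \<le> hsym (trunc_tail q l) l n * ?P"
    using small[folded l_def] nm l q by (intro hsym_trunc_tail_lower) auto
  moreover have "Z * ?P \<le> Z / Y"
  proof -
    have "?P \<le> 1 / Y" using Y Y0 by (simp add: field_simps)
    then show ?thesis using Z0 mult_left_mono[of ?P "1 / Y" Z] by simp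
  qed
  \<comment> \<open>Both \<open>l\<close> and \<open>n\<close> are at most \<open>m\<close>, the
    former because \<open>n \<ge> 1\<close>.\<close>
  moreover have "real (l + 2 * n) * q ^ l \<le> (3 * real m) * q ^ l"
    using q nm l by (intro mult_right_mono) auto
  ultimately have ratio: "1 - Z / Y \<le> 3 * real m * q ^ l" by linarith
  let ?d = "\<lambda>B. \<bar>pmf (pi_bounded m n q) B - pmf (pi_unbounded n q) B\<bar>"
  \<comment> \<open>Since \<open>W \<le> U\<close> and \<open>Z \<le> Y\<close>, both masses are at
    least \<open>W B / Y\<close>, so their distance is at most their sum minus twice this common
    part. Summing gives \<open>2 * (1 - Z / Y)\<close>.\<close>
  let ?e = "\<lambda>B. W B / Z + U B / Y - 2 * (W B / Y)"
  have d: "?d B \<le> ?e B" if "B \<in> ?S" for B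
  proof -
    have "W B / Y \<le> W B / Z" using ZY Z0 W0 by (intro divide_left_mono) auto
    moreover have "W B / Y \<le> U B / Y" using WU Y0 by (intro divide_right_mono) auto
    ultimately show ?thesis using that by (simp add: pb pu)
  qed
  have "((\<lambda>B. W B * inverse Z + U B * inverse Y + (- 2) * (W B * inverse Y))
      has_sum (Z * inverse Z + Y * inverse Y + (- 2) * (Z * inverse Y))) ?S"
    unfolding Z_def Y_def using W U
    by (intro has_sum_add has_sum_cmult_left has_sum_cmult_right has_sum_infsum)
  then have e: "(?e has_sum 2 * (1 - Z / Y)) ?S"
    using Y0 Z0 by (simp add: divide_inverse algebra_simps)
  have d_summ: "?d summable_on ?S"
    using has_sum_imp_summable[OF e] d by (rule summable_on_comparison_test) auto
  have "infsum ?d ?S \<le> 2 * (1 - Z / Y)"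
    using infsum_mono[OF d_summ has_sum_imp_summable[OF e] d] infsumI[OF e] by simp
  then show "tv_dist ?S (pi_bounded m n q) (pi_unbounded n q) \<le> 3 * real m * q ^ (m - n + 1)"
    using ratio unfolding tv_dist_def l_def by simp
  show "0 \<le> tv_dist ?S (pi_bounded m n q) (pi_unbounded n q)"
    unfolding tv_dist_def by (simp add: infsum_nonneg)
qed

theorem theorem3p1:
  fixes m n :: "nat \<Rightarrow> nat" and q :: "nat \<Rightarrow> real"
  assumes "\<And>k. k \<ge> 1 \<Longrightarrow> 1 \<le> n k \<and> n k \<le> m k"
    and "\<And>k. k \<ge> 1 \<Longrightarrow> 0 < q k \<and> q k < 1"
    and "filterlim (\<lambda>k. real (m k - n k + 1) * ln (inverse (q k)) - ln (real (m k)))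
           at_top sequentially"
  shows "(\<lambda>k. tv_dist (nsets UNIV (n k)) (pi_bounded (m k) (n k) (q k))
                (pi_unbounded (n k) (q k))) \<longlonglongrightarrow> 0"
proof -
  let ?a = "\<lambda>k. real (m k - n k + 1) * ln (inverse (q k)) - ln (real (m k))"
  let ?tv = "\<lambda>k. tv_dist (nsets UNIV (n k)) (pi_bounded (m k) (n k) (q k)) (pi_unbounded (n k) (q k))"
  have exp_a: "real (m k) * q k ^ (m k - n k + 1) = exp (- ?a k)" if "k \<ge> 1" for k
  proof -
    have "0 < q k" "0 < m k" using assms(1,2)[OF that] by auto
    moreover have "exp (- ?a k) = exp (ln (real (m k))) * exp (real (m k - n k + 1) * ln (q k))"
      using \<open>0 < q k\<close> by (simp add: ln_inverse flip: exp_add)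
    ultimately show ?thesis by (simp add: exp_of_nat_mult del: of_nat_add of_nat_Suc)
  qed
  have tv: "0 \<le> ?tv k \<and> ?tv k \<le> 3 * exp (- ?a k)" if "k \<ge> 1" "0 \<le> ?a k" for k
  proof -
    have "real (m k) * q k ^ (m k - n k + 1) \<le> 1" unfolding exp_a[OF that(1)] using that(2) by simp
    then show ?thesis
      using tv_dist_bounded_unbounded_jep[of "q k" "n k" "m k"] assms(1,2)[OF that(1)] exp_a[OF that(1)]
      by simp
  qed
  \<comment> \<open>Eventually \<open>?a k \<ge> 0\<close>, that is \<open>m q^l \<le> 1\<close>, as
    the quantitative bound requires.\<close>
  have "eventually (\<lambda>k. 0 \<le> ?a k) sequentially"
    using assms(3) unfolding filterlim_at_top by blast
  then have ev: "eventually (\<lambda>k. 0 \<le> ?tv k \<and> ?tv k \<le> 3 * exp (- ?a k)) sequentially"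
    using eventually_ge_at_top[of 1] by eventually_elim (rule tv)
  have "((\<lambda>k. exp (- ?a k)) \<longlongrightarrow> 0) sequentially"
    using assms(3) by (intro filterlim_compose[OF exp_at_bot] filterlim_compose[OF filterlim_uminus_at_bot_at_top])
  then have lim: "((\<lambda>k. 3 * exp (- ?a k)) \<longlongrightarrow> 0) sequentially"
    by (rule tendsto_mult_right_zero)
  show ?thesis
    by (rule tendsto_sandwich[OF _ _ tendsto_const lim]) (use ev in \<open>auto elim: eventually_mono\<close>)
qed

end
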